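(* Let $\mu\in\mathbb{C}$. For all integers $m,n$ for which every polynomial occurring in the respective equation has first index $\ge0$ and second index $\ge1$, the generalised Laguerre polynomials satisfy the Hirota bilinear equations \begin{align*} &\mathrm{D}_z\left(T_{m,n-1}^{(\mu+1)}\bullet T_{m,n}^{(\mu)}\right)=T_{m+1,n-1}^{(\mu)}\,T_{m-1,n}^{(\mu+1)},\\ &\mathrm{D}_z\left(T_{m,n-1}^{(\mu+1)}\bullet T_{m+1,n}^{(\mu-1)}\right)=T_{m+1,n-1}^{(\mu)}\,T_{m,n}^{(\mu)},\\ &\mathrm{D}_z\left(T_{m,n-1}^{(\mu+1)}\bullet T_{m,n}^{(\mu-1)}\right)=T_{m+1,n-1}^{(\mu)}\,T_{m-1,n}^{(\mu)},\\ &\mathrm{D}_z\left(T_{m+1,n}^{(\mu)}\bullet T_{m,n}^{(\mu+1)}\right)=T_{m+1,n-1}^{(\mu+1)}\,T_{m,n+1}^{(\mu)},\\ &\mathrm{D}_z\left(T_{m,n}^{(\mu)}\bullet T_{m,n}^{(\mu+1)}\right)=T_{m+1,n-1}^{(\mu+1)}\,T_{m-1,n+1}^{(\mu)},\\ &\mathrm{D}_z\left(T_{m+1,n}^{(\mu)}\bullet T_{m,n}^{(\mu)}\right)=T_{m+1,n-1}^{(\mu+1)}\,T_{m,n+1}^{(\mu-1)}, \end{align*} and the discrete bilinear equation $$T_{m,n}^{(\mu)}\,T_{m,n-1}^{(\mu)}-T_{m-1,n}^{(\mu)}\,T_{m+1,n-1}^{(\mu)}=T_{m,n}^{(\mu-1)}\,T_{m,n-1}^{(\mu+1)}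 .$$
   Context: $L_n^{(\alpha)}(z)=\sum_{i=0}^n \frac{(-1)^i}{i!\,(n-i)!}\Big(\prod_{l=i+1}^{n}(\alpha+l)\Big)z^i$ is the associated Laguerre polynomial ($n\ge0$, any complex $\alpha$). The generalised Laguerre polynomial is $T_{m,n}^{(\mu)}(z)=\det\left[\frac{d^{j+k}}{dz^{j+k}}L_{m+n}^{(\mu+1)}(z)\right]_{j,k=0}^{n-1}$ for integers $m\ge0$, $n\ge1$. All polynomials in the claim are functions of the same variable $z$. $\mathrm{D}_z$ is the Hirota bilinear operator $\mathrm{D}_z(f\bullet g)=\frac{df}{dz}g-f\frac{dg}{dz}$. *)

theory Defs
  imports Complex_Main "Jordan_Normal_Form.Determinant"
begin

definition laguerre :: "nat \<Rightarrow> complex \<Rightarrow> complex poly" where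
  "laguerre n \<alpha> =
     (\<Sum>i\<le>n. monom ((-1) ^ i / (fact i * fact (n - i)) * (\<Prod>l = i+1..n. \<alpha> + of_nat l)) i)"

text \<open>The matrix is \<open>n \<times> n\<close> with indices starting at 0. The intended range is \<open>n \<ge> 1\<close>;
  for \<open>n = 0\<close> the empty determinant gives 1.\<close>

definition gen_laguerre :: "nat \<Rightarrow> nat \<Rightarrow> complex \<Rightarrow> complex poly" where
  "gen_laguerre m n \<mu> =
     det (mat n n (\<lambda>(j, k). (pderiv ^^ (j + k)) (laguerre (m + n) (\<mu> + 1))))"

definition hirota :: "complex poly \<Rightarrow> complex poly \<Rightarrow> complex poly" where
  "hirota f g = pderiv f * g - f * pderiv g"

end

theory Submission
  imports Defs
begin

text \<open>
  Write \<open>D\<close> for differentiation. The relations \<open>D L_N^(a) = - L_{N-1}^(a+1)\<close> and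
  \<open>(1 - D) L_N^(a) = L_N^(a+1)\<close> express all Laguerre polynomials in one equation as \<open>r(D) f\<close>
  for a single \<open>f\<close>, with \<open>r\<close> a product of factors \<open>-X\<close> and \<open>1 - X\<close>. Thus every
  \<open>T\<close> is a Gram determinant \<open>det [(p_i q_j)(D) f]\<close>, which depends on the \<open>p_i\<close> and the
  \<open>q_j\<close> only up to unimodular change of basis, and its derivative is obtained by replacing
  \<open>X^(n-1)\<close> by \<open>X^n\<close> among the \<open>p_i\<close>. With suitable bases the first three
  equations and the discrete one become three-term Pluecker relations, and the other three become
  Desnanot-Jacobi identities. Neither depends on \<open>f\<close> being a Laguerre polynomial.
\<close>

section \<open>Determinants of lists of rows\<close>

text \<open>Rows are functions on all of \<open>nat\<close>, of which only the entries below the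
  number of rows count. Rows can thus be inserted, dropped and permuted by list operations, and the
  size adjusts by itself.\<close>

definition rdet :: "(nat \<Rightarrow> 'a::comm_ring_1) list \<Rightarrow> 'a" where
  "rdet vs = det (mat (length vs) (length vs) (\<lambda>(i, j). (vs ! i) j))"

text \<open>Laplace expansion along the first row; precomposing with the shift deletes column
  \<open>j\<close>. The coefficient of \<open>v j\<close> does not involve \<open>v\<close>, so this
  also shows linearity in the first row.\<close>

lemma rdet_Cons:
  "rdet (v # vs) = (\<Sum>j\<le>length vs. v j * ((-1) ^ j *
     rdet (map (\<lambda>w b. w (if b < j then b else Suc b)) vs)))"
proof -
  let ?n = "Suc (length vs)"
  let ?A = "mat ?n ?n (\<lambda>(i, j). ((v # vs) ! i) j)"
  have "det ?A = (\<Sum>j<?n. ?A $$ (0, j) * cofactor ?A 0 j)"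
    by (rule laplace_expansion_row) auto
  also have "\<dots> = (\<Sum>j<?n. v j * ((-1) ^ j *
     rdet (map (\<lambda>w b. w (if b < j then b else Suc b)) vs)))"
  proof (rule sum.cong)
    fix j assume "j \<in> {..<?n}"
    have "mat_delete ?A 0 j = mat (length vs) (length vs)
        (\<lambda>(i, b). (map (\<lambda>w b. w (if b < j then b else Suc b)) vs ! i) b)"
      unfolding mat_delete_def by (rule eq_matI) auto
    then show "?A $$ (0, j) * cofactor ?A 0 j = v j * ((-1) ^ j *
        rdet (map (\<lambda>w b. w (if b < j then b else Suc b)) vs))"
      using \<open>j \<in> {..<?n}\<close> by (simp add: cofactor_def rdet_def)
  qed simp
  finally show ?thesis
    by (simp add: rdet_def lessThan_Suc_atMost)
qed

lemma rdet_eq_rows: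
  assumes "i < j" "j < length vs" "vs ! i = vs ! j"
  shows "rdet vs = 0"
  unfolding rdet_def
  by (rule det_identical_rows[of _ "length vs" i j]) (use assms in \<open>auto intro!: eq_vecI\<close>)

lemma rdet_swap: "rdet (us @ v # w # vs) = - rdet (us @ w # v # vs)"
proof -
  let ?k = "length us" and ?n = "length us + length vs + 2"
  let ?A = "mat ?n ?n (\<lambda>(i, j). ((us @ w # v # vs) ! i) j)"
  have "rdet (us @ v # w # vs) = det (swaprows ?k (Suc ?k) ?A)"
    unfolding rdet_def by (rule arg_cong[of _ _ det], rule eq_matI) 
      (auto simp: nth_append nth_Cons split: nat.splits)
  also have "\<dots> = - det ?A"
    by (rule det_swaprows[of _ ?n]) auto
  finally show ?thesis
    by (simp add: rdet_def)
qed

lemma rdet_rotate: "rdet (us @ v # vs) = (-1) ^ length vs * rdet (us @ vs @ [v])"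
proof (induction vs arbitrary: us)
  case (Cons w vs)
  show ?case
    using Cons.IH[of "us @ [w]"] by (simp add: rdet_swap[of us v w vs])
qed simp

text \<open>The sum is the expansion of a determinant that has the column of the \<open>j\<close>-th entries twice.\<close>

lemma rdet_relation:
  assumes "j < n" "length ws = Suc n"
  shows "(\<Sum>i\<le>n. (-1) ^ i * rdet (take i ws @ drop (Suc i) ws) * (ws ! i) j) = 0"
proof -
  let ?M = "mat (Suc n) (Suc n) (\<lambda>(i, b). (ws ! i) (case b of 0 \<Rightarrow> j | Suc b \<Rightarrow> b))"
  have "det ?M = 0"
    by (rule det_identical_columns[of _ "Suc n" 0 "Suc j"]) 
      (use assms in \<open>auto intro!: eq_vecI\<close>)
  moreover have "det ?M = (\<Sum>i<Suc n. ?M $$ (i, 0) * cofactor ?M i 0)"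
    by (rule laplace_expansion_column) auto
  moreover have "?M $$ (i, 0) * cofactor ?M i 0 =
      (-1) ^ i * rdet (take i ws @ drop (Suc i) ws) * (ws ! i) j" if "i < Suc n" for i
  proof -
    have "mat_delete ?M i 0 = mat n n (\<lambda>(a, b). ((take i ws @ drop (Suc i) ws) ! a) b)"
      unfolding mat_delete_def
      by (rule eq_matI) (use that assms in \<open>auto simp: nth_append min_def\<close>)
    moreover have "length (take i ws @ drop (Suc i) ws) = n"
      using that assms by simp
    ultimately have "rdet (take i ws @ drop (Suc i) ws) = det (mat_delete ?M i 0)"
      unfolding rdet_def by presburger
    then show ?thesis
      using that by (simp add: cofactor_def mult_ac)
  qed
  ultimately show ?thesis
    by (simp add: lessThan_Suc_atMost)
qed

text \<open>Expand the second factor along its first row \<open>ws ! i\<close>. The cofactors do not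
  depend on \<open>i\<close>, so after interchanging the sums each column \<open>j\<close>
  contributes a multiple of the vanishing sum in \<open>rdet_relation\<close>.\<close>

lemma rdet_exchange:
  assumes "length ws = Suc (Suc (length ys))"
  shows "(\<Sum>i\<le>Suc (length ys). (-1) ^ i * rdet (take i ws @ drop (Suc i) ws) * rdet (ws ! i # ys)) = 0"
    (is "(\<Sum>i\<le>?n. ?d i * _ i) = 0")
proof -
  let ?c = "\<lambda>j. (-1) ^ j * rdet (map (\<lambda>w b. w (if b < j then b else Suc b)) ys)"
  have "(\<Sum>i\<le>?n. ?d i * rdet (ws ! i # ys)) =
      (\<Sum>i\<le>?n. \<Sum>j\<le>length ys. ?d i * (ws ! i) j * ?c j)"
    unfolding rdet_Cons sum_distrib_left by (simp only: mult.assoc)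
  also have "\<dots> = (\<Sum>j\<le>length ys. (\<Sum>i\<le>?n. ?d i * (ws ! i) j) * ?c j)"
    by (subst sum.swap) (simp only: sum_distrib_right)
  also have "\<dots> = (\<Sum>j\<le>length ys. 0 * ?c j)"
    by (rule sum.cong) (use rdet_relation[OF _ assms] in auto)
  finally show ?thesis
    by simp
qed

text \<open>In the exchange relation for \<open>u # v # w # vs\<close> against
  \<open>z # vs\<close>, moving a row of \<open>vs\<close> produces a determinant with a repeated
  row. Only the terms that move \<open>u\<close>, \<open>v\<close> or \<open>w\<close>
  survive.\<close>

lemma rdet_pluecker:
  "rdet (v # w # vs) * rdet (u # z # vs) - rdet (u # w # vs) * rdet (v # z # vs)
    + rdet (u # v # vs) * rdet (w # z # vs) = 0"
proof -
  let ?ws = "u # v # w # vs"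
  let ?d = "\<lambda>i. (-1) ^ i * rdet (take i ?ws @ drop (Suc i) ?ws) * rdet (?ws ! i # z # vs)"
  have "(\<Sum>i<3 + length vs. ?d i) = 0"
    using rdet_exchange[of ?ws "z # vs"] by (simp add: lessThan_Suc_atMost numeral_3_eq_3)
  moreover have "(\<Sum>i<3 + length vs. ?d i) = (\<Sum>i<3. ?d i)"
  proof (rule sum.mono_neutral_right)
    show "\<forall>i\<in>{..<3 + length vs} - {..<3}. ?d i = 0"
    proof
      fix i assume "i \<in> {..<3 + length vs} - {..<3}"
      then have i: "i \<ge> 3" "i < 3 + length vs" by auto
      have "rdet (?ws ! i # z # vs) = 0"
        by (rule rdet_eq_rows[of 0 "i - 1"]) 
          (use i in \<open>auto simp: nth_Cons' numeral_3_eq_3\<close>)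
      then show "?d i = 0" by simp
    qed
  qed auto
  ultimately show ?thesis
    by (simp add: numeral_3_eq_3 lessThan_Suc algebra_simps)
qed

text \<open>The product rule, one row at a time, by induction through the expansion along the first
  row.\<close>

lemma pderiv_rdet:
  "pderiv (rdet vs) = (\<Sum>i<length vs. rdet (vs[i := \<lambda>j. pderiv ((vs ! i) j)]))"
proof (induction "length vs" arbitrary: vs)
  case 0
  then show ?case by (simp add: rdet_def)
next
  case (Suc n)
  then obtain v ws where vs: "vs = v # ws" and n: "length ws = n"
    by (cases vs) auto
  let ?m = "\<lambda>j ws. map (\<lambda>w b. w (if b < j then b else Suc b)) ws"
  \<comment> \<open>Deleting a column commutes with differentiating a row, so the induction
    hypothesis for the minors can be stated in terms of \<open>ws\<close>.\<close>
  have IH: "pderiv (rdet (?m j ws)) =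
      (\<Sum>i<n. rdet (?m j (ws[i := \<lambda>j. pderiv ((ws ! i) j)])))" for j
  proof -
    have "pderiv (rdet (?m j ws)) =
        (\<Sum>i<n. rdet ((?m j ws)[i := \<lambda>b. pderiv ((?m j ws ! i) b)]))"
      using Suc.hyps(1)[of "?m j ws"] n by simp
    also have "\<dots> = (\<Sum>i<n. rdet (?m j (ws[i := \<lambda>j. pderiv ((ws ! i) j)])))"
      using n by (intro sum.cong refl arg_cong[of _ _ rdet]) (simp add: map_update)
    finally show ?thesis .
  qed
  have sgn: "(-1) ^ j * q = smult ((-1) ^ j) q" for j and q :: "'a poly"
    by (induction j) auto
  have "pderiv (rdet vs) =
      rdet ((\<lambda>j. pderiv (v j)) # ws) +
      (\<Sum>j\<le>n. v j * ((-1) ^ j * (\<Sum>i<n. rdet (?m j (ws[i := \<lambda>j. pderiv ((ws ! i) j)])))))"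
    unfolding vs rdet_Cons n sgn higher_pderiv_sum[of 1, simplified] pderiv_mult pderiv_smult IH
    by (simp add: sum.distrib algebra_simps)
  also have "(\<Sum>j\<le>n. v j * ((-1) ^ j * (\<Sum>i<n. rdet (?m j (ws[i := \<lambda>j. pderiv ((ws ! i) j)]))))) =
      (\<Sum>i<n. rdet (v # ws[i := \<lambda>j. pderiv ((ws ! i) j)]))"
    unfolding rdet_Cons sum_distrib_left length_list_update n by (rule sum.swap)
  also have "rdet ((\<lambda>j. pderiv (v j)) # ws) + \<dots> =
      (\<Sum>i<Suc n. rdet (vs[i := \<lambda>j. pderiv ((vs ! i) j)]))"
    unfolding sum.lessThan_Suc_shift by (simp add: vs)
  finally show ?case
    using Suc.hyps(2) by simp
qed

section \<open>Pluecker and Desnanot-Jacobi relations for Gram determinants\<close>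

definition gram :: "('p \<Rightarrow> 'q \<Rightarrow> 'a::comm_ring_1) \<Rightarrow> 'p list \<Rightarrow> 'q list \<Rightarrow> 'a" where
  "gram B ps qs = rdet (map (\<lambda>p j. B p (qs ! j)) ps)"

text \<open>A unit row in front deletes its column. All determinants in \<open>rdet_pluecker\<close>
  have the same size; unit rows let minors of smaller size enter it.\<close>

lemma rdet_unit_0:
  "rdet ((\<lambda>j. if j = 0 then 1 else 0) # vs) = rdet (map (\<lambda>v j. v (Suc j)) vs)"
  unfolding rdet_Cons by (subst sum.atMost_shift) simp

lemma rdet_unit_1:
  "rdet ((\<lambda>j. if j = 1 then 1 else 0) # w # vs) =
    - rdet (map (\<lambda>v j. v (if j < 1 then j else Suc j)) (w # vs))"
proof -
  have "rdet ((\<lambda>j. if j = 1 then 1 else 0) # w # vs) =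
      (\<Sum>j\<in>{1}. (-1) ^ j * rdet (map (\<lambda>v b. v (if b < j then b else Suc b)) (w # vs)))"
    unfolding rdet_Cons[of _ "w # vs"] by (rule sum.mono_neutral_cong_right) auto
  then show ?thesis by simp
qed

lemma gram_unit_0:
  "rdet ((\<lambda>j. if j = 0 then 1 else 0) # map (\<lambda>p j. B p ((q # qs) ! j)) ps) = gram B ps qs"
  unfolding rdet_unit_0 gram_def by (simp add: o_def)

lemma gram_unit_1:
  "rdet ((\<lambda>j. if j = 1 then 1 else 0) # map (\<lambda>p j. B p ((q # q' # qs) ! j)) (p # ps)) =
    - gram B (p # ps) (q # qs)"
proof -
  have "B p ((q # q' # qs) ! (if j < 1 then j else Suc j)) = B p ((q # qs) ! j)" for p j
    by (simp add: nth_Cons')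
  then show ?thesis
    unfolding gram_def list.map(2) rdet_unit_1 list.map_comp o_def by (simp only:)
qed

lemma gram_swap: "gram B (us @ v # w # vs) qs = - gram B (us @ w # v # vs) qs"
  unfolding gram_def map_append list.map by (rule rdet_swap)

lemma gram_rotate: "gram B (us @ v # vs) qs = (-1) ^ length vs * gram B (us @ vs @ [v]) qs"
  by (simp add: gram_def rdet_rotate[of "map _ us"])

text \<open>This is \<open>rdet_pluecker\<close> for the four rows of \<open>p\<close>,
  \<open>p'\<close>, \<open>p''\<close> and the unit row of column \<open>q\<close>. The three
  determinants that contain the unit row lose that column.\<close>

lemma gram_pluecker:
  "gram B (p # p' # ps) (q # qs) * gram B (p'' # ps) qs
    - gram B (p # p'' # ps) (q # qs) * gram B (p' # ps) qs
    + gram B (p' # p'' # ps) (q # qs) * gram B (p # ps) qs = 0"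
proof -
  let ?e = "\<lambda>j. if j = 0 then 1 else 0 :: 'a"
  have *: "rdet ((\<lambda>j. B r ((q # qs) ! j)) # ?e # map (\<lambda>p j. B p ((q # qs) ! j)) ps) =
      - gram B (r # ps) qs" for r
    using rdet_swap[of "[]" "\<lambda>j. B r ((q # qs) ! j)" ?e "map (\<lambda>p j. B p ((q # qs) ! j)) ps"]
      gram_unit_0[of B q qs "r # ps"] by simp
  have "x3 * y3 - x2 * y2 + x1 * y1 = 0" if "x1 * - y1 - x2 * - y2 + x3 * - y3 = 0"
    for x1 x2 x3 y1 y2 y3 :: 'a
    using that by (simp add: algebra_simps)
  from this[OF rdet_pluecker[of "\<lambda>j. B p' ((q # qs) ! j)" "\<lambda>j. B p'' ((q # qs) ! j)"
        "map (\<lambda>p j. B p ((q # qs) ! j)) ps" "\<lambda>j. B p ((q # qs) ! j)" ?e, unfolded *]]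
  show ?thesis
    unfolding gram_def list.map .
qed

text \<open>Here two of the four distinguished rows in \<open>rdet_pluecker\<close> are the unit
  rows of the columns \<open>q\<close> and \<open>q'\<close>; the other two belong to
  \<open>p\<close> and \<open>p'\<close>.\<close>

lemma gram_jacobi:
  "gram B (p # p' # ps) (q # q' # qs) * gram B ps qs =
    gram B (p # ps) (q # qs) * gram B (p' # ps) (q' # qs)
    - gram B (p # ps) (q' # qs) * gram B (p' # ps) (q # qs)"
proof -
  let ?r = "\<lambda>p j. B p ((q # q' # qs) ! j)"
  let ?e = "\<lambda>j. if j = 0 then 1 else 0 :: 'a" and ?e' = "\<lambda>j. if j = 1 then 1 else 0 :: 'a"
  have 0: "rdet (?r x # ?e # map ?r ps) = - gram B (x # ps) (q' # qs)" for x
    using rdet_swap[of "[]" "?r x" ?e "map ?r ps"] gram_unit_0[of B q "q' # qs" "x # ps"] by simp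
  have 1: "rdet (?r x # ?e' # map ?r ps) = gram B (x # ps) (q # qs)" for x
    using rdet_swap[of "[]" "?r x" ?e' "map ?r ps"] gram_unit_1[of B q q' qs x ps] by simp
  \<comment> \<open>With both unit rows present, deleting column 0 turns the unit row of column 1
    into that of the new column 0, so the second deletion has the same form.\<close>
  have "rdet (?e # ?e' # map ?r ps) = rdet (map (\<lambda>v j. v (Suc j)) (?e' # map ?r ps))"
    by (rule rdet_unit_0)
  also have "\<dots> = rdet (?e # map (\<lambda>p j. B p ((q' # qs) ! j)) ps)"
    by (simp add: o_def)
  also have "\<dots> = gram B ps qs"
    by (rule gram_unit_0)
  finally show ?thesis
    using rdet_pluecker[of "?r p'" ?e "map ?r ps" "?r p" ?e'] unfolding 0 1
    by (simp add: gram_def algebra_simps)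
qed

lemma gram_rotate2: "gram B (p # p' # ps) qs = gram B (ps @ [p, p']) qs"
proof -
  let ?e = "(-1) ^ length ps"
  have "gram B (p # p' # ps) qs = ?e * gram B (p # ps @ [p']) qs"
    using gram_rotate[of B "[p]" p' ps qs] by simp
  also have "gram B (p # ps @ [p']) qs = (-1) ^ Suc (length ps) * gram B (ps @ [p', p]) qs"
    using gram_rotate[of B "[]" p "ps @ [p']" qs] by simp
  also have "gram B (ps @ [p', p]) qs = - gram B (ps @ [p, p']) qs"
    by (rule gram_swap)
  finally show ?thesis by simp
qed

text \<open>The form needed for lists of increasing powers, whose top powers stand last. In each
  product the signs from moving rows occur in pairs and cancel.\<close>

lemma gram_pluecker_snoc:
  "gram B (p # ps @ [p']) (q # qs) * gram B (ps @ [p'']) qs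
    - gram B (p # ps @ [p'']) (q # qs) * gram B (ps @ [p']) qs
    + gram B (ps @ [p', p'']) (q # qs) * gram B (p # ps) qs = 0"
proof -
  let ?e = "(-1) ^ length ps :: 'a"
  have 1: "gram B (x # ps) qs' = ?e * gram B (ps @ [x]) qs'"
    and 2: "gram B (p # x # ps) qs' = ?e * gram B (p # ps @ [x]) qs'" for x qs'
    using gram_rotate[of B "[]" x ps qs'] gram_rotate[of B "[p]" x ps qs'] by simp_all
  have "0 = (?e * gram B (p # ps @ [p']) (q # qs)) * (?e * gram B (ps @ [p'']) qs)
    - (?e * gram B (p # ps @ [p'']) (q # qs)) * (?e * gram B (ps @ [p']) qs)
    + gram B (ps @ [p', p'']) (q # qs) * gram B (p # ps) qs"
    unfolding 1[symmetric] 2[symmetric] gram_rotate2[symmetric]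
    by (rule gram_pluecker[symmetric])
  also have "\<dots> = (?e * ?e) * (gram B (p # ps @ [p']) (q # qs) * gram B (ps @ [p'']) qs)
    - (?e * ?e) * (gram B (p # ps @ [p'']) (q # qs) * gram B (ps @ [p']) qs)
    + gram B (ps @ [p', p'']) (q # qs) * gram B (p # ps) qs"
    by (simp only: mult_ac)
  finally show ?thesis by simp
qed

lemma gram_jacobi_snoc:
  "gram B (ps @ [p, p']) (q # q' # qs) * gram B ps qs =
    gram B (ps @ [p]) (q # qs) * gram B (ps @ [p']) (q' # qs)
    - gram B (ps @ [p]) (q' # qs) * gram B (ps @ [p']) (q # qs)"
proof -
  let ?e = "(-1) ^ length ps :: 'a"
  have "gram B (x # ps) qs' = ?e * gram B (ps @ [x]) qs'" for x qs'
    using gram_rotate[of B "[]" x ps qs'] by simp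
  then have "gram B (ps @ [p, p']) (q # q' # qs) * gram B ps qs =
    (?e * gram B (ps @ [p]) (q # qs)) * (?e * gram B (ps @ [p']) (q' # qs))
    - (?e * gram B (ps @ [p]) (q' # qs)) * (?e * gram B (ps @ [p']) (q # qs))"
    using gram_jacobi[of B p p' ps q q' qs] by (simp only: gram_rotate2)
  also have "\<dots> = (?e * ?e) * (gram B (ps @ [p]) (q # qs) * gram B (ps @ [p']) (q' # qs))
    - (?e * ?e) * (gram B (ps @ [p]) (q' # qs) * gram B (ps @ [p']) (q # qs))"
    by (simp only: mult_ac)
  finally show ?thesis by simp
qed

section \<open>Hankel determinants of derivatives\<close>

text \<open>\<open>poly_D p f\<close> is \<open>p(D) f\<close>.\<close>

definition poly_D :: "'a::idom poly \<Rightarrow> 'a poly \<Rightarrow> 'a poly" where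
  "poly_D p f = fold_coeffs (\<lambda>a g. smult a f + pderiv g) p 0"

lemma poly_D_0 [simp]: "poly_D 0 f = 0"
  by (simp add: poly_D_def)

lemma poly_D_pCons [simp]: "poly_D (pCons a p) f = smult a f + pderiv (poly_D p f)"
  by (cases "p = 0 \<and> a = 0") (auto simp: poly_D_def)

lemma poly_D_1 [simp]: "poly_D 1 f = f"
  by (simp add: one_pCons)

lemma poly_D_add: "poly_D (p + q) f = poly_D p f + poly_D q f"
  by (induction p q rule: poly_induct2) (auto simp: smult_add_left pderiv_add)

lemma poly_D_smult: "poly_D (smult c p) f = smult c (poly_D p f)"
  by (induction p) (auto simp: smult_add_right pderiv_smult)

lemma poly_D_sum: "poly_D (sum p A) f = (\<Sum>a\<in>A. poly_D (p a) f)"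
  by (induction A rule: infinite_finite_induct) (auto simp: poly_D_add)

lemma poly_D_mult: "poly_D (p * q) f = poly_D p (poly_D q f)"
  by (induction p) (auto simp: poly_D_add poly_D_smult)

lemma poly_D_monom: "poly_D (monom 1 k) f = (pderiv ^^ k) f"
  by (induction k) (auto simp: monom_0 monom_Suc)

text \<open>The form sees \<open>p\<close> and \<open>q\<close> only through their product. It is
  therefore symmetric, and a common factor can be shifted between rows and columns.\<close>

abbreviation hgram :: "'a::idom poly \<Rightarrow> 'a poly list \<Rightarrow> 'a poly list \<Rightarrow> 'a poly" where
  "hgram f \<equiv> gram (\<lambda>p q. poly_D (p * q) f)"

definition monoms :: "'a::idom poly \<Rightarrow> nat \<Rightarrow> 'a poly list" where
  "monoms r n = map (\<lambda>i. r * monom 1 i) [0..<n]"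

lemma length_monoms [simp]: "length (monoms r n) = n"
  by (simp add: monoms_def)

lemma nth_monoms [simp]: "i < n \<Longrightarrow> monoms r n ! i = r * monom 1 i"
  by (simp add: monoms_def)

lemma monoms_snoc: "monoms r (Suc n) = monoms r n @ [r * monom 1 n]"
  by (simp add: monoms_def)

lemma monoms_Cons: "monoms r (Suc n) = r # monoms (r * monom 1 1) n"
  by (simp add: monoms_def map_upt_Suc mult_monom mult.assoc del: upt_Suc)

lemma map_mult_monoms: "map ((*) s) (monoms r n) = monoms (s * r) n"
  by (simp add: monoms_def mult.assoc)

text \<open>By transposition. It carries every change of basis proved for rows over to
  columns.\<close>

lemma hgram_commute:
  assumes "length ps = length qs"
  shows "hgram f ps qs = hgram f qs ps"
proof -
  let ?n = "length ps"
  let ?A = "\<lambda>ps qs. mat ?n ?n (\<lambda>(i, j). poly_D (ps ! i * qs ! j) f)"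
  have *: "hgram f ps qs = det (?A ps qs)" if "length ps = ?n" for ps qs
    unfolding gram_def rdet_def length_map that
    by (rule arg_cong[of _ _ det], rule eq_matI) (use that in auto)
  have "transpose_mat (?A ps qs) = ?A qs ps"
    by (rule eq_matI) (auto simp: mult.commute)
  then show ?thesis
    using det_transpose[of "?A ps qs" ?n] assms by (simp add: *)
qed

text \<open>The matrix of coefficients of \<open>ps\<close> is lower triangular with ones on the
  diagonal, so passing to the basis of powers of X multiplies the determinant by 1.\<close>

lemma hgram_monic:
  assumes "\<And>i. i < length ps \<Longrightarrow> degree (ps ! i) = i \<and> coeff (ps ! i) i = 1"
  shows "hgram f (map ((*) r) ps) qs = hgram f (monoms r (length ps)) qs"
proof -
  let ?n = "length ps"
  let ?U = "mat ?n ?n (\<lambda>(i, k). [:coeff (ps ! i) k:])"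
  let ?M = "mat ?n ?n (\<lambda>(k, j). poly_D (r * monom 1 k * qs ! j) f)"
  let ?N = "mat ?n ?n (\<lambda>(i, j). poly_D (r * ps ! i * qs ! j) f)"
  have "?N $$ (i, j) = (?U * ?M) $$ (i, j)" if "i < ?n" "j < ?n" for i j
  proof -
    have "ps ! i = (\<Sum>k\<le>degree (ps ! i). monom (coeff (ps ! i) k) k)"
      by (rule poly_as_sum_of_monoms[symmetric])
    also have "\<dots> = (\<Sum>k<?n. monom (coeff (ps ! i) k) k)"
      by (rule sum.mono_neutral_left) (use assms[of i] that in \<open>auto simp: not_le coeff_eq_0\<close>)
    finally have "r * ps ! i * qs ! j = r * (\<Sum>k<?n. monom (coeff (ps ! i) k) k) * qs ! j"
      by (rule arg_cong)
    also have "\<dots> = (\<Sum>k<?n. r * monom (coeff (ps ! i) k) k * qs ! j)"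
      unfolding sum_distrib_left sum_distrib_right ..
    also have "\<dots> = (\<Sum>k<?n. smult (coeff (ps ! i) k) (r * monom 1 k * qs ! j))"
    proof (rule sum.cong)
      fix k
      have "monom (coeff (ps ! i) k) k = smult (coeff (ps ! i) k) (monom 1 k)"
        by (simp add: smult_monom)
      then show "r * monom (coeff (ps ! i) k) k * qs ! j = smult (coeff (ps ! i) k) (r * monom 1 k * qs ! j)"
        by (simp only: mult_smult_left mult_smult_right)
    qed simp
    finally have "poly_D (r * ps ! i * qs ! j) f =
        (\<Sum>k<?n. smult (coeff (ps ! i) k) (poly_D (r * monom 1 k * qs ! j) f))"
      by (simp only: poly_D_sum poly_D_smult)
    then show ?thesis
      using that by (simp add: scalar_prod_def atLeast0LessThan)
  qed
  then have "?N = ?U * ?M"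
    by (intro eq_matI) auto
  moreover have "det ?U = 1"
  proof -
    have "det ?U = prod_list (diag_mat ?U)"
      by (rule det_lower_triangular[of ?n]) (use assms in \<open>auto intro!: coeff_eq_0\<close>)
    also have "diag_mat ?U = map (\<lambda>i. 1) [0..<?n]"
      unfolding diag_mat_def using assms by (intro map_cong) (auto simp: one_pCons)
    finally show ?thesis by (simp add: map_replicate_const)
  qed
  ultimately have "det ?N = det ?M"
    by (simp add: det_mult[of _ ?n])
  moreover have "hgram f (map ((*) r) ps) qs = det ?N" "hgram f (monoms r ?n) qs = det ?M"
    unfolding gram_def rdet_def by (auto intro!: arg_cong[of _ _ det] eq_matI)
  ultimately show ?thesis by simp
qed

text \<open>Differentiation multiplies a row polynomial by X. Every row except the last then
  coincides with its successor, so only the term that differentiates the last row remains.\<close>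

lemma pderiv_hgram_monoms:
  "pderiv (hgram f (monoms r (Suc n)) qs) = hgram f (monoms r n @ [r * monom 1 (Suc n)]) qs"
proof -
  let ?r = "\<lambda>p j. poly_D (p * qs ! j) f"
  let ?vs = "map ?r (monoms r (Suc n))"
  have D: "(\<lambda>j. pderiv ((?vs ! i) j)) = ?r (r * monom 1 (Suc i))" if "i \<le> n" for i
    using that by (auto simp: fun_eq_iff monom_Suc mult_ac)
  have "pderiv (rdet ?vs) = (\<Sum>i<Suc n. rdet (?vs[i := ?r (r * monom 1 (Suc i))]))"
    unfolding pderiv_rdet by (intro sum.cong) (auto simp del: nth_map simp: D)
  also have "\<dots> = rdet (?vs[n := ?r (r * monom 1 (Suc n))])"
  proof -
    have "rdet (?vs[i := ?r (r * monom 1 (Suc i))]) = 0" if "i < n" for i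
      by (rule rdet_eq_rows[of i "Suc i"]) (use that in auto)
    then show ?thesis by simp
  qed
  also have "?vs[n := ?r (r * monom 1 (Suc n))] = map ?r (monoms r n @ [r * monom 1 (Suc n)])"
    by (simp add: monoms_snoc list_update_append)
  finally show ?thesis
    by (simp add: gram_def)
qed

text \<open>The Hankel determinant of the derivatives of \<open>poly_D r f\<close>. Keeping
  \<open>r\<close> apart from \<open>f\<close> makes determinants with different \<open>r\<close>
  comparable over one \<open>f\<close>.\<close>

definition hankel :: "'a::idom poly \<Rightarrow> 'a poly \<Rightarrow> nat \<Rightarrow> 'a poly" where
  "hankel f r n = hgram f (monoms 1 n) (monoms r n)"

lemma hankel_eq_det:
  "hankel f r n = det (mat n n (\<lambda>(j, k). (pderiv ^^ (j + k)) (poly_D r f)))"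
  unfolding hankel_def gram_def rdet_def
  by (auto intro!: arg_cong[of _ _ det] eq_matI
      simp: poly_D_mult[symmetric] poly_D_monom[symmetric] mult_monom mult_ac)

lemma hgram_monoms: "hgram f (monoms r n) (monoms s n) = hankel f (r * s) n"
  unfolding hankel_def gram_def rdet_def
  by (auto intro!: arg_cong[of _ _ det] eq_matI simp: mult_ac)

lemma pderiv_hgram_monoms':
  "hgram f (monoms r n @ [r * monom 1 (Suc n)]) (monoms s (Suc n)) = pderiv (hankel f (r * s) (Suc n))"
  using pderiv_hgram_monoms[of f r n "monoms s (Suc n)"] by (simp add: hgram_monoms)

lemma hgram_monic_rows:
  assumes "\<And>i. i < length ps \<Longrightarrow> degree (ps ! i) = i \<and> coeff (ps ! i) i = 1"
  shows "hgram f ps qs = hgram f (monoms 1 (length ps)) qs"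
proof -
  have "map ((*) 1) ps = ps" by (simp add: list_eq_iff_nth_eq)
  then show ?thesis using hgram_monic[OF assms, of f 1 qs] by simp
qed

lemma monic_mult_monom:
  fixes s :: "'a::idom poly"
  assumes "degree s = d" "coeff s d = 1"
  shows "degree (s * monom 1 i) = d + i \<and> coeff (s * monom 1 i) (d + i) = 1"
proof -
  have "s \<noteq> 0" using assms by auto
  then have "degree (s * monom 1 i) = d + i"
    using assms by (simp add: degree_mult_eq degree_monom_eq)
  moreover have "coeff (s * monom 1 i) (d + i) = 1"
    using coeff_mult_degree_sum[of s "monom 1 i"] assms by (simp add: degree_monom_eq)
  ultimately show ?thesis by blast
qed

text \<open>The polynomials 1, s, s X, s X^2, ... are monic of degrees 0, 1, 2, 3, ...\<close>

lemma hgram_one_Cons_monoms: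
  assumes "degree s = 1" "coeff s 1 = 1"
  shows "hgram f (1 # monoms s k) qs = hgram f (monoms 1 (Suc k)) qs"
  using hgram_monic_rows[of "1 # monoms s k" f qs] monic_mult_monom[OF assms]
  by (auto simp: nth_Cons split: nat.splits)

text \<open>Subtracting the second row from the first replaces s by s - t = 1. The list 1, t, s t, s
  t X, ... is then monic of degrees 0, 1, 2, 3, ...\<close>

lemma hgram_two_linear_Cons_monoms:
  fixes s t :: "'a::idom poly"
  assumes "s - t = 1" "degree t = 1" "coeff t 1 = 1"
  shows "hgram f (s # t # monoms (s * t) k) qs = hgram f (monoms 1 (Suc (Suc k))) qs"
proof -
  have st: "s = 1 + t" using assms(1) by (simp add: algebra_simps)
  then have s: "degree s = 1" "coeff s 1 = 1"
    using assms degree_add_eq_right[of 1 t] by (auto simp: coeff_1)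
  let ?r = "\<lambda>p j. poly_D (p * qs ! j) f"
  have "rdet ((\<lambda>j. u j + v j) # vs) = rdet (u # vs) + rdet (v # vs)"
    for u v :: "nat \<Rightarrow> 'a poly" and vs
    unfolding rdet_Cons by (simp add: distrib_right sum.distrib)
  from this[of "?r 1" "?r t" "map ?r (t # monoms (s * t) k)"]
  have "hgram f (s # t # monoms (s * t) k) qs =
      hgram f (1 # t # monoms (s * t) k) qs + hgram f (t # t # monoms (s * t) k) qs"
    by (simp add: gram_def st poly_D_add distrib_right)
  also have "hgram f (t # t # monoms (s * t) k) qs = 0"
    unfolding gram_def by (rule rdet_eq_rows[of 0 1]) auto
  also have "hgram f (1 # t # monoms (s * t) k) qs = hgram f (monoms 1 (Suc (Suc k))) qs"
  proof -
    have "s \<noteq> 0" "t \<noteq> 0" using s assms by auto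
    then have "degree (s * t) = 2" using s assms by (simp add: degree_mult_eq)
    moreover have "coeff (s * t) 2 = 1"
      using coeff_mult_degree_sum[of s t] s assms by (simp add: numeral_2_eq_2)
    ultimately show ?thesis
      using hgram_monic_rows[of "1 # t # monoms (s * t) k" f qs] monic_mult_monom[of "s * t" 2] assms
      by (auto simp: nth_Cons split: nat.splits)
  qed
  finally show ?thesis by simp
qed

text \<open>The relation is applied to the distinguished rows \<open>1\<close>, \<open>X^(k+1)\<close>, \<open>X^(k+2)\<close>
  and the common rows \<open>X, ..., X^k\<close>.\<close>

lemma pluecker_hankel:
  assumes col: "\<And>ps. length ps = Suc (Suc k) \<Longrightarrow>
      hgram f ps (q # monoms s (Suc k)) = c * hgram f ps (monoms 1 (Suc (Suc k)))"
    and "c \<noteq> 0"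
  shows "pderiv (hankel f (monom 1 1 * s) (Suc k)) * hankel f 1 (Suc (Suc k))
     - hankel f (monom 1 1 * s) (Suc k) * pderiv (hankel f 1 (Suc (Suc k)))
     = - (hankel f s (Suc k) * hankel f (monom 1 1) (Suc (Suc k)))"
proof -
  let ?X = "monom 1 1 :: 'a poly" and ?p = "monom 1 (Suc k)" and ?p' = "monom 1 (Suc (Suc k))"
  let ?Q = "monoms s (Suc k)"
  have rows: "1 # monoms ?X k @ [?p] = monoms 1 (Suc (Suc k))"
    "1 # monoms ?X k @ [?p'] = monoms 1 (Suc k) @ [1 * ?p']"
    "monoms ?X k @ [?p] = monoms ?X (Suc k)"
    "monoms ?X k @ [?p'] = monoms ?X k @ [?X * monom 1 (Suc k)]"
    "monoms ?X k @ [?p, ?p'] = monoms ?X (Suc (Suc k))"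
    "1 # monoms ?X k = monoms 1 (Suc k)"
    by (simp_all add: monoms_snoc[of 1 "Suc k"] monoms_Cons[of 1 k] monoms_snoc[of ?X "Suc k"]
        monoms_snoc[of ?X k] mult_monom Suc_eq_plus1_left[symmetric] del: One_nat_def)
  \<comment> \<open>The larger determinants have the columns of \<open>col\<close> and so carry the
    constant \<open>c\<close>. The smaller ones drop \<open>q\<close>, and their factor is the row
    factor, 1 or X, times \<open>s\<close>. Lists that skip X^(k+1) but end in X^(k+2), or skip X^k
    but end in X^(k+1) after removing a factor X, give derivatives.\<close>
  have "hgram f (1 # monoms ?X k @ [?p]) (q # ?Q) * hgram f (monoms ?X k @ [?p']) ?Q
    - hgram f (1 # monoms ?X k @ [?p']) (q # ?Q) * hgram f (monoms ?X k @ [?p]) ?Q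
    + hgram f (monoms ?X k @ [?p, ?p']) (q # ?Q) * hgram f (1 # monoms ?X k) ?Q = 0"
    by (rule gram_pluecker_snoc)
  then have "c * hankel f 1 (Suc (Suc k)) * pderiv (hankel f (?X * s) (Suc k))
    - c * pderiv (hankel f 1 (Suc (Suc k))) * hankel f (?X * s) (Suc k)
    + c * hankel f ?X (Suc (Suc k)) * hankel f s (Suc k) = 0"
    unfolding rows(1,2,5,6) unfolding rows(3,4)
    by (simp add: col hgram_monoms pderiv_hgram_monoms' del: mult_1_left One_nat_def) simp
  then have "c * (hankel f 1 (Suc (Suc k)) * pderiv (hankel f (?X * s) (Suc k))
    - pderiv (hankel f 1 (Suc (Suc k))) * hankel f (?X * s) (Suc k)
    + hankel f ?X (Suc (Suc k)) * hankel f s (Suc k)) = 0" (is "c * ?Z = 0")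
    by (simp only: ring_distribs mult_ac)
  with \<open>c \<noteq> 0\<close> have "?Z = 0" by (simp only: mult_eq_0_iff) simp
  then show ?thesis by (simp add: algebra_simps)
qed

text \<open>The common rows are 1, ..., X^(k-1), the distinguished ones X^k and X^(k+1). Adding X^k
  to the common rows gives a Hankel determinant, adding X^(k+1) its derivative. The constants
  \<open>c\<close>, \<open>c'\<close>, \<open>d\<close> come from changing the column bases.\<close>

lemma jacobi_hankel:
  assumes "\<And>ps. length ps = Suc k \<Longrightarrow> hgram f ps (q # monoms r k) = c * hgram f ps (monoms s (Suc k))"
    and "\<And>ps. length ps = Suc k \<Longrightarrow> hgram f ps (q' # monoms r k) = c' * hgram f ps (monoms t (Suc k))"
    and "\<And>ps. length ps = Suc (Suc k) \<Longrightarrow>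
      hgram f ps (q # q' # monoms r k) = d * hgram f ps (monoms 1 (Suc (Suc k)))"
  shows "c * c' * (pderiv (hankel f s (Suc k)) * hankel f t (Suc k)
      - hankel f s (Suc k) * pderiv (hankel f t (Suc k)))
     = - (d * (hankel f r k * hankel f 1 (Suc (Suc k))))"
proof -
  let ?p = "monom 1 k :: 'a poly" and ?p' = "monom 1 (Suc k) :: 'a poly" and ?Q = "monoms r k"
  have rows: "monoms 1 k @ [?p, ?p'] = monoms 1 (Suc (Suc k))"
    "monoms 1 k @ [?p] = monoms 1 (Suc k)"
    "monoms 1 k @ [?p'] = monoms 1 k @ [1 * ?p']"
    by (simp_all add: monoms_snoc)
  have "hgram f (monoms 1 k @ [?p, ?p']) (q # q' # ?Q) * hgram f (monoms 1 k) ?Q =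
    hgram f (monoms 1 k @ [?p]) (q # ?Q) * hgram f (monoms 1 k @ [?p']) (q' # ?Q)
    - hgram f (monoms 1 k @ [?p]) (q' # ?Q) * hgram f (monoms 1 k @ [?p']) (q # ?Q)"
    by (rule gram_jacobi_snoc)
  then have "d * hankel f 1 (Suc (Suc k)) * hankel f r k =
    c * hankel f s (Suc k) * (c' * pderiv (hankel f t (Suc k)))
    - c' * hankel f t (Suc k) * (c * pderiv (hankel f s (Suc k)))"
    unfolding rows by (simp add: assms hgram_monoms pderiv_hgram_monoms' del: mult_1_left) simp
  then show ?thesis by (simp add: algebra_simps)
qed

section \<open>Bilinear identities for Hankel determinants of an arbitrary polynomial\<close>

lemma hankel_pluecker_1:
  "pderiv (hankel f (monom 1 1) (Suc k)) * hankel f 1 (Suc (Suc k))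
     - hankel f (monom 1 1) (Suc k) * pderiv (hankel f 1 (Suc (Suc k)))
     = - (hankel f 1 (Suc k) * hankel f (monom 1 1) (Suc (Suc k)))"
proof -
  \<comment> \<open>With q = X^(k+1) and s = 1 the columns are a cyclic rotation of the powers of X,
    so the constant is just a sign.\<close>
  have "hgram f ps (monom 1 (Suc k) # monoms 1 (Suc k)) =
      (-1) ^ Suc k * hgram f ps (monoms 1 (Suc (Suc k)))" if "length ps = Suc (Suc k)" for ps
    using that gram_rotate[of _ "[]" "monom 1 (Suc k)" "monoms 1 (Suc k)" ps]
    by (simp add: hgram_commute[of ps] monoms_snoc[of 1 "Suc k"])
  from pluecker_hankel[OF this] show ?thesis by simp
qed

lemma hankel_pluecker_linear:
  assumes "degree s = 1" "coeff s 1 = 1"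
  shows "pderiv (hankel f (monom 1 1 * s) (Suc k)) * hankel f 1 (Suc (Suc k))
     - hankel f (monom 1 1 * s) (Suc k) * pderiv (hankel f 1 (Suc (Suc k)))
     = - (hankel f s (Suc k) * hankel f (monom 1 1) (Suc (Suc k)))"
proof -
  have "hgram f ps (1 # monoms s (Suc k)) = 1 * hgram f ps (monoms 1 (Suc (Suc k)))"
    if "length ps = Suc (Suc k)" for ps
    using that by (simp add: hgram_commute[of ps] hgram_one_Cons_monoms[OF assms])
  from pluecker_hankel[OF this] show ?thesis by simp
qed

text \<open>Take q = 1 and q' = s X^k next to the columns s, ..., s X^(k-1). Adding q alone gives a
  basis in degrees up to k, adding q' alone a rotation of the multiples of s, and adding both a
  rotated basis in degrees up to k+1. The sign (-1)^k cancels.\<close>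

lemma hankel_jacobi_linear:
  assumes "degree s = 1" "coeff s 1 = 1"
  shows "pderiv (hankel f 1 (Suc k)) * hankel f s (Suc k)
      - hankel f 1 (Suc k) * pderiv (hankel f s (Suc k))
     = - (hankel f s k * hankel f 1 (Suc (Suc k)))"
proof -
  let ?q = "s * monom 1 k"
  have "hgram f ps (1 # monoms s k) = 1 * hgram f ps (monoms 1 (Suc k))"
    if "length ps = Suc k" for ps
    using that by (simp add: hgram_commute[of ps] hgram_one_Cons_monoms[OF assms])
  moreover have "hgram f ps (?q # monoms s k) = (-1) ^ k * hgram f ps (monoms s (Suc k))"
    if "length ps = Suc k" for ps
    using that gram_rotate[of _ "[]" ?q "monoms s k" ps]
    by (simp add: hgram_commute[of ps] monoms_snoc)
  moreover have "hgram f ps (1 # ?q # monoms s k) = (-1) ^ k * hgram f ps (monoms 1 (Suc (Suc k)))"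
    if "length ps = Suc (Suc k)" for ps
    using that gram_rotate[of "\<lambda>p q. poly_D (p * q) f" "[1]" ?q "monoms s k" ps]
      hgram_one_Cons_monoms[OF assms, of f "Suc k" ps]
    by (simp add: hgram_commute[of ps] monoms_snoc[of s])
  ultimately have "1 * (-1) ^ k * (pderiv (hankel f 1 (Suc k)) * hankel f s (Suc k)
      - hankel f 1 (Suc k) * pderiv (hankel f s (Suc k)))
     = - ((-1) ^ k * (hankel f s k * hankel f 1 (Suc (Suc k))))"
    by (rule jacobi_hankel)
  then have "(-1) ^ k * (pderiv (hankel f 1 (Suc k)) * hankel f s (Suc k)
      - hankel f 1 (Suc k) * pderiv (hankel f s (Suc k)))
     = (-1) ^ k * (- (hankel f s k * hankel f 1 (Suc (Suc k))))"
    by simp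
  then show ?thesis
    by (subst (asm) mult_cancel_left) auto
qed

context
  fixes s t :: "'a::idom poly"
  assumes st: "s - t = 1" "degree s = 1" "coeff s 1 = 1" "degree t = 1" "coeff t 1 = 1"
begin

text \<open>After the common factor s is taken out, the list s, s t, s t X, ... becomes 1, t, t X,
  ..., which is monic of degrees 0, 1, 2, ...; likewise with s and t exchanged.\<close>

lemma hgram_linear_Cons_monoms:
  "hgram f (s # monoms (s * t) k) qs = hgram f (monoms s (Suc k)) qs"
  "hgram f (t # monoms (s * t) k) qs = hgram f (monoms t (Suc k)) qs"
proof -
  have *: "hgram f (u # monoms (u * v) k) qs = hgram f (monoms u (Suc k)) qs"
    if "degree v = 1" "coeff v 1 = 1" for u v
    using hgram_monic[of "1 # monoms v k" f u qs] monic_mult_monom[OF that]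
    by (auto simp: nth_Cons map_mult_monoms split: nat.splits)
  show "hgram f (s # monoms (s * t) k) qs = hgram f (monoms s (Suc k)) qs"
    "hgram f (t # monoms (s * t) k) qs = hgram f (monoms t (Suc k)) qs"
    using *[of t s] *[of s t] st by (simp_all add: mult.commute)
qed

text \<open>The distinguished columns are s and t next to the multiples of s t. All three changes of
  basis are unimodular, so no constant arises.\<close>

lemma hankel_jacobi_two_linear:
  "pderiv (hankel f t (Suc k)) * hankel f s (Suc k)
      - hankel f t (Suc k) * pderiv (hankel f s (Suc k))
     = hankel f (s * t) k * hankel f 1 (Suc (Suc k))"
proof -
  have "hgram f ps (s # monoms (s * t) k) = 1 * hgram f ps (monoms s (Suc k))"
    "hgram f ps (t # monoms (s * t) k) = 1 * hgram f ps (monoms t (Suc k))"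
    if "length ps = Suc k" for ps
    using that by (simp_all add: hgram_commute[of ps] hgram_linear_Cons_monoms)
  moreover have "hgram f ps (s # t # monoms (s * t) k) = 1 * hgram f ps (monoms 1 (Suc (Suc k)))"
    if "length ps = Suc (Suc k)" for ps
    using that by (simp add: hgram_commute[of ps] hgram_two_linear_Cons_monoms[OF st(1,4,5)])
  ultimately have "1 * 1 * (pderiv (hankel f s (Suc k)) * hankel f t (Suc k)
      - hankel f s (Suc k) * pderiv (hankel f t (Suc k)))
     = - (1 * (hankel f (s * t) k * hankel f 1 (Suc (Suc k))))"
    by (intro jacobi_hankel)
  then show ?thesis by (simp add: algebra_simps)
qed

text \<open>The Pluecker relation with distinguished rows s, t and s t X^k, common rows s t X^i for
  i < k, and X^(k+1) as the extra column. No power is skipped in any list, so no derivative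
  appears.\<close>

lemma hankel_discrete:
  "hankel f s (Suc (Suc k)) * hankel f t (Suc k) - hankel f t (Suc (Suc k)) * hankel f s (Suc k)
    = hankel f 1 (Suc (Suc k)) * hankel f (s * t) (Suc k)"
proof -
  let ?P = "monoms (s * t) k" and ?p = "s * t * monom 1 k"
  let ?q = "monom 1 (Suc k) :: 'a poly" and ?Q = "monoms 1 (Suc k) :: 'a poly list"
  let ?e = "(-1) ^ k :: 'a poly" and ?e' = "(-1) ^ Suc k :: 'a poly"
  have Q: "hgram f ps (?q # ?Q) = ?e' * hgram f ps (monoms 1 (Suc (Suc k)))"
    if "length ps = Suc (Suc k)" for ps
    using that gram_rotate[of _ "[]" ?q ?Q ps]
    by (simp add: hgram_commute[of ps] monoms_snoc[of 1 "Suc k"])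
  have P: "hgram f (?p # ?P) qs = ?e * hgram f (monoms (s * t) (Suc k)) qs"
    "hgram f (u # ?p # ?P) qs = ?e * hgram f (u # monoms (s * t) (Suc k)) qs" for u qs
    using gram_rotate[of _ "[]" ?p ?P qs] gram_rotate[of _ "[u]" ?p ?P qs]
    by (simp_all add: monoms_snoc)
  have "hgram f (s # t # ?P) (?q # ?Q) * hgram f (?p # ?P) ?Q
    - hgram f (s # ?p # ?P) (?q # ?Q) * hgram f (t # ?P) ?Q
    + hgram f (t # ?p # ?P) (?q # ?Q) * hgram f (s # ?P) ?Q = 0"
    by (rule gram_pluecker)
  then have "?e' * hankel f 1 (Suc (Suc k)) * (?e * hankel f (s * t) (Suc k))
    - ?e * (?e' * hankel f s (Suc (Suc k))) * hankel f t (Suc k)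
    + ?e * (?e' * hankel f t (Suc (Suc k))) * hankel f s (Suc k) = 0"
    unfolding P by (simp only: Q length_Cons length_monoms hgram_linear_Cons_monoms 
        hgram_two_linear_Cons_monoms[OF st(1,4,5)] hgram_monoms mult_1_left mult_1_right)
  then have "?e' * ?e * (hankel f 1 (Suc (Suc k)) * hankel f (s * t) (Suc k)
    - hankel f s (Suc (Suc k)) * hankel f t (Suc k)
    + hankel f t (Suc (Suc k)) * hankel f s (Suc k)) = 0"
    by (simp only: ring_distribs mult_ac)
  then show ?thesis by (simp add: algebra_simps)
qed

end

section \<open>Laguerre polynomials\<close>

lemma coeff_laguerre:
  "coeff (laguerre n \<alpha>) i =
    (if i \<le> n then (-1) ^ i / (fact i * fact (n - i)) * (\<Prod>l = i+1..n. \<alpha> + of_nat l) else 0)"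
  by (auto simp: laguerre_def coeff_sum)

text \<open>Compare coefficients: the index of the product shifts by one, and (i+1)/(i+1)! =
  1/i!.\<close>

lemma pderiv_laguerre: "pderiv (laguerre (Suc n) \<alpha>) = - laguerre n (\<alpha> + 1)"
proof (rule poly_eqI)
  fix i
  have *: "(\<Prod>l = Suc (Suc i)..Suc n. \<alpha> + of_nat l) = (\<Prod>l = Suc i..n. \<alpha> + 1 + of_nat l)"
    by (subst prod.shift_bounds_cl_Suc_ivl) (simp add: add_ac)
  have "of_nat (Suc i) / (fact (Suc i) :: complex) = 1 / fact i"
    by (simp add: divide_simps del: of_nat_Suc)
  then have "of_nat (Suc i) * ((-1) ^ Suc i / (fact (Suc i) * fact (n - i)) * P) =
      - ((-1) ^ i / (fact i * fact (n - i)) * P)" for P :: complex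
    by (simp add: field_simps del: of_nat_Suc fact_Suc)
  then show "coeff (pderiv (laguerre (Suc n) \<alpha>)) i = coeff (- laguerre n (\<alpha> + 1)) i"
    by (simp add: coeff_pderiv coeff_laguerre * del: of_nat_Suc fact_Suc power_Suc prod.cl_ivl_Suc)
qed

text \<open>For i < n the products for \<open>\<alpha>\<close> and \<open>\<alpha> + 1\<close> share
  the factor \<open>Q\<close>, with remaining factors \<open>\<alpha>\<close> + i + 1 and
  \<open>\<alpha>\<close> + n + 1. Their difference n - i is what the derivative supplies, as
  1/(n-i-1)! = (n-i)/(n-i)!.\<close>

lemma laguerre_add_one: "laguerre n (\<alpha> + 1) = laguerre n \<alpha> - pderiv (laguerre n \<alpha>)"
proof (rule poly_eqI)
  fix i
  show "coeff (laguerre n (\<alpha> + 1)) i = coeff (laguerre n \<alpha> - pderiv (laguerre n \<alpha>)) i"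
  proof (cases "i < n")
    case True
    then obtain k where n: "n = Suc (i + k)"
      by (auto dest: less_imp_Suc_add)
    define Q where "Q = (\<Prod>l = Suc (Suc i)..n. \<alpha> + of_nat l)"
    have "(\<Prod>l = Suc i..n. \<alpha> + of_nat l) = (\<alpha> + of_nat (Suc i)) * Q"
      unfolding Q_def using True by (subst prod.atLeast_Suc_atMost) auto
    moreover have "(\<Prod>l = Suc i..n. \<alpha> + 1 + of_nat l) = Q * (\<alpha> + of_nat (Suc n))"
    proof -
      have "(\<Prod>l = Suc i..n. \<alpha> + 1 + of_nat l) = (\<Prod>l = Suc (Suc i)..Suc n. \<alpha> + of_nat l)"
        by (subst prod.shift_bounds_cl_Suc_ivl) (simp add: add_ac)
      then show ?thesis
        unfolding Q_def using True by simp
    qed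
    ultimately show ?thesis
      using True Q_def
      by (simp add: coeff_pderiv coeff_laguerre n field_simps del: of_nat_Suc)
        (simp add: field_simps)
  qed (auto simp: coeff_pderiv coeff_laguerre)
qed

lemma poly_D_uminus: "poly_D (- p) f = - poly_D p f"
  using poly_D_smult[of "-1" p f] by simp

lemma poly_D_diff: "poly_D (p - q) f = poly_D p f - poly_D q f"
  using poly_D_add[of p "- q" f] by (simp add: poly_D_uminus)

lemma poly_D_laguerre_Suc: "poly_D (- monom 1 1) (laguerre (Suc n) \<alpha>) = laguerre n (\<alpha> + 1)"
  by (simp add: poly_D_uminus poly_D_monom pderiv_laguerre del: One_nat_def) (simp add: pderiv_laguerre)

text \<open>The factor 1 - X is written as -(X - 1) because the Hankel identities use monic linear
  factors; \<open>hankel_uminus\<close> takes the sign out.\<close>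

lemma poly_D_laguerre_add_one: "poly_D (- (monom 1 1 - 1)) (laguerre n \<alpha>) = laguerre n (\<alpha> + 1)"
  by (simp add: poly_D_uminus poly_D_diff poly_D_monom laguerre_add_one)

lemma hankel_uminus: "hankel f (- r) n = (-1) ^ n * hankel f r n"
proof -
  let ?A = "\<lambda>r. mat n n (\<lambda>(i, j). poly_D (monom 1 i * (r * monom 1 j)) f)"
  have *: "hankel f r n = det (?A r)" for r
    unfolding hankel_def gram_def rdet_def by (auto intro!: arg_cong[of _ _ det] eq_matI)
  have "?A (- r) = (-1) \<cdot>\<^sub>m ?A r"
    by (rule eq_matI) (auto simp: poly_D_uminus)
  then show ?thesis
    by (simp add: * det_smult)
qed

section \<open>Generalised Laguerre polynomials as Hankel determinants over a common
  polynomial\<close>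

lemma gen_laguerre_eq_hankel:
  assumes "laguerre (m + n) (\<mu> + 1) = poly_D r f"
  shows "gen_laguerre m n \<mu> = hankel f r n"
  by (simp add: gen_laguerre_def hankel_eq_det assms)

text \<open>This and the next four facts form a dictionary: a factor X lowers the degree and raises
  the parameter, a factor X - 1 only raises the parameter. \<open>N\<close> and
  \<open>\<alpha>\<close> enter through equations so that one base polynomial serves a whole
  bilinear equation.\<close>

lemma gen_laguerre_hankel_1:
  "N = m + n \<Longrightarrow> \<alpha> = \<mu> + 1 \<Longrightarrow> gen_laguerre m n \<mu> = hankel (laguerre N \<alpha>) 1 n"
  by (rule gen_laguerre_eq_hankel) simp

lemma gen_laguerre_hankel_X:
  "N = Suc (m + n) \<Longrightarrow> \<alpha> = \<mu> \<Longrightarrow>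
    gen_laguerre m n \<mu> = (-1) ^ n * hankel (laguerre N \<alpha>) (monom 1 1) n"
  unfolding hankel_uminus[symmetric] by (rule gen_laguerre_eq_hankel) (simp only: poly_D_laguerre_Suc)

lemma gen_laguerre_hankel_Y:
  "N = m + n \<Longrightarrow> \<alpha> = \<mu> \<Longrightarrow>
    gen_laguerre m n \<mu> = (-1) ^ n * hankel (laguerre N \<alpha>) (monom 1 1 - 1) n"
  unfolding hankel_uminus[symmetric] by (rule gen_laguerre_eq_hankel) (simp only: poly_D_laguerre_add_one)

lemma gen_laguerre_hankel_X_X:
  assumes "N = Suc (Suc (m + n))" "\<alpha> + 1 = \<mu>"
  shows "gen_laguerre m n \<mu> = hankel (laguerre N \<alpha>) (monom 1 1 * monom 1 1) n"
proof -
  have "laguerre (m + n) (\<mu> + 1) = poly_D (- monom 1 1 * - monom 1 1) (laguerre N \<alpha>)"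
    unfolding assms(1) assms(2)[symmetric] by (simp only: poly_D_mult poly_D_laguerre_add_one poly_D_laguerre_Suc)
  from gen_laguerre_eq_hankel[OF this] show ?thesis
    by (simp only: minus_mult_minus)
qed

lemma gen_laguerre_hankel_X_Y:
  assumes "N = Suc (m + n)" "\<alpha> + 1 = \<mu>"
  shows "gen_laguerre m n \<mu> = hankel (laguerre N \<alpha>) (monom 1 1 * (monom 1 1 - 1)) n"
proof -
  have "laguerre (m + n) (\<mu> + 1) = poly_D (- monom 1 1 * - (monom 1 1 - 1)) (laguerre N \<alpha>)"
    unfolding assms(1) assms(2)[symmetric] by (simp only: poly_D_mult poly_D_laguerre_add_one poly_D_laguerre_Suc)
  from gen_laguerre_eq_hankel[OF this] show ?thesis
    by (simp only: minus_mult_minus)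
qed

lemma linear_monom:
  "degree (monom 1 1 :: 'a::idom poly) = 1" "coeff (monom 1 1 :: 'a poly) 1 = 1"
  "degree (monom 1 1 - 1 :: 'a poly) = 1" "coeff (monom 1 1 - 1 :: 'a poly) 1 = 1"
proof -
  have "monom 1 1 - 1 = ([:-1, 1:] :: 'a poly)"
    by (simp add: monom_Suc monom_0 one_pCons)
  then show "degree (monom 1 1 - 1 :: 'a poly) = 1" "coeff (monom 1 1 - 1 :: 'a poly) 1 = 1"
    by simp_all
qed (simp_all add: degree_monom_eq)

lemma hirota_sign:
  "hirota ((-1) ^ i * g) h = (-1) ^ i * hirota g h"
  "hirota g ((-1) ^ i * h) = (-1) ^ i * hirota g h"
proof -
  have "pderiv ((-1) ^ i * g) = (-1) ^ i * pderiv g" for g :: "complex poly"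
    by (induction i) (simp_all add: pderiv_minus)
  then show "hirota ((-1) ^ i * g) h = (-1) ^ i * hirota g h"
    "hirota g ((-1) ^ i * h) = (-1) ^ i * hirota g h"
    by (simp_all add: hirota_def algebra_simps)
qed

text \<open>The bound 2 on \<open>n\<close> keeps the second index n - 1 at least 1, and
  \<open>1 \<le> m\<close> is imposed exactly where m - 1 occurs. All subtractions of naturals are
  therefore exact.\<close>

theorem lemma3p13:
  fixes \<mu> :: complex and m n :: nat
  shows
    "(1 \<le> m \<and> 2 \<le> n \<longrightarrow>
        hirota (gen_laguerre m (n - 1) (\<mu> + 1)) (gen_laguerre m n \<mu>)
        = gen_laguerre (m + 1) (n - 1) \<mu> * gen_laguerre (m - 1) n (\<mu> + 1))
   \<and> (2 \<le> n \<longrightarrow>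
        hirota (gen_laguerre m (n - 1) (\<mu> + 1)) (gen_laguerre (m + 1) n (\<mu> - 1))
        = gen_laguerre (m + 1) (n - 1) \<mu> * gen_laguerre m n \<mu>)
   \<and> (1 \<le> m \<and> 2 \<le> n \<longrightarrow>
        hirota (gen_laguerre m (n - 1) (\<mu> + 1)) (gen_laguerre m n (\<mu> - 1))
        = gen_laguerre (m + 1) (n - 1) \<mu> * gen_laguerre (m - 1) n \<mu>)
   \<and> (2 \<le> n \<longrightarrow>
        hirota (gen_laguerre (m + 1) n \<mu>) (gen_laguerre m n (\<mu> + 1))
        = gen_laguerre (m + 1) (n - 1) (\<mu> + 1) * gen_laguerre m (n + 1) \<mu>)
   \<and> (1 \<le> m \<and> 2 \<le> n \<longrightarrow>
        hirota (gen_laguerre m n \<mu>) (gen_laguerre m n (\<mu> + 1))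
        = gen_laguerre (m + 1) (n - 1) (\<mu> + 1) * gen_laguerre (m - 1) (n + 1) \<mu>)
   \<and> (2 \<le> n \<longrightarrow>
        hirota (gen_laguerre (m + 1) n \<mu>) (gen_laguerre m n \<mu>)
        = gen_laguerre (m + 1) (n - 1) (\<mu> + 1) * gen_laguerre m (n + 1) (\<mu> - 1))
   \<and> (1 \<le> m \<and> 2 \<le> n \<longrightarrow>
        gen_laguerre m n \<mu> * gen_laguerre m (n - 1) \<mu>
          - gen_laguerre (m - 1) n \<mu> * gen_laguerre (m + 1) (n - 1) \<mu>
        = gen_laguerre m n (\<mu> - 1) * gen_laguerre m (n - 1) (\<mu> + 1))"
proof (intro conjI impI)
  let ?X = "monom 1 1 :: complex poly" and ?Y = "monom 1 1 - 1 :: complex poly"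
  have XY: "?X - ?Y = 1" by simp
  {
    assume "1 \<le> m \<and> 2 \<le> n"
    then have "m = Suc (m - 1)" "n = Suc (Suc (n - 2))" by auto
    then obtain m' k where mn: "m = Suc m'" "n = Suc (Suc k)" by blast
    \<comment> \<open>As in each later equation, \<open>f\<close> has the highest degree and the
      lowest parameter that occur, so all other Laguerre polynomials arise from it by factors -X and
      1 - X. Here one factor -X suffices.\<close>
    define f where "f = laguerre (m + n) (\<mu> + 1)"
    have "gen_laguerre m (n - 1) (\<mu> + 1) = (-1) ^ Suc k * hankel f ?X (Suc k)"
      using gen_laguerre_hankel_X[of "m + n" m "n - 1" "\<mu> + 1" "\<mu> + 1"] by (simp add: mn f_def)
    moreover have "gen_laguerre m n \<mu> = hankel f 1 (Suc (Suc k))"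
      using gen_laguerre_hankel_1[of "m + n" m n "\<mu> + 1" \<mu>] by (simp add: mn f_def)
    moreover have "gen_laguerre (m + 1) (n - 1) \<mu> = hankel f 1 (Suc k)"
      using gen_laguerre_hankel_1[of "m + n" "m + 1" "n - 1" "\<mu> + 1" \<mu>] by (simp add: mn f_def)
    moreover have "gen_laguerre (m - 1) n (\<mu> + 1) = (-1) ^ Suc (Suc k) * hankel f ?X (Suc (Suc k))"
      using gen_laguerre_hankel_X[of "m + n" "m - 1" n "\<mu> + 1" "\<mu> + 1"] by (simp add: mn f_def)
    ultimately show "hirota (gen_laguerre m (n - 1) (\<mu> + 1)) (gen_laguerre m n \<mu>)
        = gen_laguerre (m + 1) (n - 1) \<mu> * gen_laguerre (m - 1) n (\<mu> + 1)"
      using hankel_pluecker_1[of f k, folded hirota_def]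
      by (simp only: hirota_sign) (simp add: mult_ac)
  }
  {
    assume "2 \<le> n"
    then have "n = Suc (Suc (n - 2))" by auto
    then obtain k where n: "n = Suc (Suc k)" by blast
    \<comment> \<open>Two factors -X lead from \<open>f\<close> to the polynomial of the first
      determinant, so the linear Pluecker identity applies with s = X.\<close>
    define f where "f = laguerre (m + 1 + n) \<mu>"
    have "gen_laguerre m (n - 1) (\<mu> + 1) = hankel f (?X * ?X) (Suc k)"
      using gen_laguerre_hankel_X_X[of "m + 1 + n" m "n - 1" \<mu> "\<mu> + 1"] by (simp add: n f_def)
    moreover have "gen_laguerre (m + 1) n (\<mu> - 1) = hankel f 1 (Suc (Suc k))"
      using gen_laguerre_hankel_1[of "m + 1 + n" "m + 1" n \<mu> "\<mu> - 1"] by (simp add: n f_def)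
    moreover have "gen_laguerre (m + 1) (n - 1) \<mu> = (-1) ^ Suc k * hankel f ?X (Suc k)"
      using gen_laguerre_hankel_X[of "m + 1 + n" "m + 1" "n - 1" \<mu> \<mu>] by (simp add: n f_def)
    moreover have "gen_laguerre m n \<mu> = (-1) ^ Suc (Suc k) * hankel f ?X (Suc (Suc k))"
      using gen_laguerre_hankel_X[of "m + 1 + n" m n \<mu> \<mu>] by (simp add: n f_def)
    ultimately show "hirota (gen_laguerre m (n - 1) (\<mu> + 1)) (gen_laguerre (m + 1) n (\<mu> - 1))
        = gen_laguerre (m + 1) (n - 1) \<mu> * gen_laguerre m n \<mu>"
      using hankel_pluecker_linear[OF linear_monom(1,2), of f k, folded hirota_def]
      by (simp only: hirota_sign) (simp add: mult_ac)
  }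
  {
    assume "1 \<le> m \<and> 2 \<le> n"
    then have "m = Suc (m - 1)" "n = Suc (Suc (n - 2))" by auto
    then obtain m' k where mn: "m = Suc m'" "n = Suc (Suc k)" by blast
    \<comment> \<open>The same identity as for the previous equation, now with s = X - 1.\<close>
    define f where "f = laguerre (m + n) \<mu>"
    have "gen_laguerre m (n - 1) (\<mu> + 1) = hankel f (?X * ?Y) (Suc k)"
      using gen_laguerre_hankel_X_Y[of "m + n" m "n - 1" \<mu> "\<mu> + 1"] by (simp add: mn f_def)
    moreover have "gen_laguerre m n (\<mu> - 1) = hankel f 1 (Suc (Suc k))"
      using gen_laguerre_hankel_1[of "m + n" m n \<mu> "\<mu> - 1"] by (simp add: mn f_def)
    moreover have "gen_laguerre (m + 1) (n - 1) \<mu> = (-1) ^ Suc k * hankel f ?Y (Suc k)"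
      using gen_laguerre_hankel_Y[of "m + n" "m + 1" "n - 1" \<mu> \<mu>] by (simp add: mn f_def)
    moreover have "gen_laguerre (m - 1) n \<mu> = (-1) ^ Suc (Suc k) * hankel f ?X (Suc (Suc k))"
      using gen_laguerre_hankel_X[of "m + n" "m - 1" n \<mu> \<mu>] by (simp add: mn f_def)
    ultimately show "hirota (gen_laguerre m (n - 1) (\<mu> + 1)) (gen_laguerre m n (\<mu> - 1))
        = gen_laguerre (m + 1) (n - 1) \<mu> * gen_laguerre (m - 1) n \<mu>"
      using hankel_pluecker_linear[OF linear_monom(3,4), of f k, folded hirota_def]
      by (simp only: hirota_sign) (simp add: mult_ac)
  }
  {
    assume "2 \<le> n"
    then have "n = Suc (Suc (n - 2))" by auto
    then obtain k where n: "n = Suc (Suc k)" by blast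
    \<comment> \<open>The sizes n - 1, n and n + 1 call for a Jacobi identity at
      \<open>Suc k\<close>, here with s = X; the next equation uses s = X - 1.\<close>
    define f where "f = laguerre (m + 1 + n) (\<mu> + 1)"
    have "gen_laguerre (m + 1) n \<mu> = hankel f 1 (Suc (Suc k))"
      using gen_laguerre_hankel_1[of "m + 1 + n" "m + 1" n "\<mu> + 1" \<mu>] by (simp add: n f_def)
    moreover have "gen_laguerre m n (\<mu> + 1) = (-1) ^ Suc (Suc k) * hankel f ?X (Suc (Suc k))"
      using gen_laguerre_hankel_X[of "m + 1 + n" m n "\<mu> + 1" "\<mu> + 1"] by (simp add: n f_def)
    moreover have "gen_laguerre (m + 1) (n - 1) (\<mu> + 1) = (-1) ^ Suc k * hankel f ?X (Suc k)"
      using gen_laguerre_hankel_X[of "m + 1 + n" "m + 1" "n - 1" "\<mu> + 1" "\<mu> + 1"]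
      by (simp add: n f_def)
    moreover have "gen_laguerre m (n + 1) \<mu> = hankel f 1 (Suc (Suc (Suc k)))"
      using gen_laguerre_hankel_1[of "m + 1 + n" m "n + 1" "\<mu> + 1" \<mu>] by (simp add: n f_def)
    ultimately show "hirota (gen_laguerre (m + 1) n \<mu>) (gen_laguerre m n (\<mu> + 1))
        = gen_laguerre (m + 1) (n - 1) (\<mu> + 1) * gen_laguerre m (n + 1) \<mu>"
      using hankel_jacobi_linear[OF linear_monom(1,2), of f "Suc k", folded hirota_def]
      by (simp only: hirota_sign) (simp add: mult_ac)
  }
  {
    assume "1 \<le> m \<and> 2 \<le> n"
    then have "m = Suc (m - 1)" "n = Suc (Suc (n - 2))" by auto
    then obtain m' k where mn: "m = Suc m'" "n = Suc (Suc k)" by blast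
    define f where "f = laguerre (m + n) (\<mu> + 1)"
    have "gen_laguerre m n \<mu> = hankel f 1 (Suc (Suc k))"
      using gen_laguerre_hankel_1[of "m + n" m n "\<mu> + 1" \<mu>] by (simp add: mn f_def)
    moreover have "gen_laguerre m n (\<mu> + 1) = (-1) ^ Suc (Suc k) * hankel f ?Y (Suc (Suc k))"
      using gen_laguerre_hankel_Y[of "m + n" m n "\<mu> + 1" "\<mu> + 1"] by (simp add: mn f_def)
    moreover have "gen_laguerre (m + 1) (n - 1) (\<mu> + 1) = (-1) ^ Suc k * hankel f ?Y (Suc k)"
      using gen_laguerre_hankel_Y[of "m + n" "m + 1" "n - 1" "\<mu> + 1" "\<mu> + 1"]
      by (simp add: mn f_def)
    moreover have "gen_laguerre (m - 1) (n + 1) \<mu> = hankel f 1 (Suc (Suc (Suc k)))"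
      using gen_laguerre_hankel_1[of "m + n" "m - 1" "n + 1" "\<mu> + 1" \<mu>] by (simp add: mn f_def)
    ultimately show "hirota (gen_laguerre m n \<mu>) (gen_laguerre m n (\<mu> + 1))
        = gen_laguerre (m + 1) (n - 1) (\<mu> + 1) * gen_laguerre (m - 1) (n + 1) \<mu>"
      using hankel_jacobi_linear[OF linear_monom(3,4), of f "Suc k", folded hirota_def]
      by (simp only: hirota_sign) (simp add: mult_ac)
  }
  {
    assume "2 \<le> n"
    then have "n = Suc (Suc (n - 2))" by auto
    then obtain k where n: "n = Suc (Suc k)" by blast
    \<comment> \<open>Both X and X - 1 occur; since they differ by 1, the Jacobi identity for two
      linear factors applies.\<close>
    define f where "f = laguerre (m + 1 + n) \<mu>"
    have "gen_laguerre (m + 1) n \<mu> = (-1) ^ Suc (Suc k) * hankel f ?Y (Suc (Suc k))"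
      using gen_laguerre_hankel_Y[of "m + 1 + n" "m + 1" n \<mu> \<mu>] by (simp add: n f_def)
    moreover have "gen_laguerre m n \<mu> = (-1) ^ Suc (Suc k) * hankel f ?X (Suc (Suc k))"
      using gen_laguerre_hankel_X[of "m + 1 + n" m n \<mu> \<mu>] by (simp add: n f_def)
    moreover have "gen_laguerre (m + 1) (n - 1) (\<mu> + 1) = hankel f (?X * ?Y) (Suc k)"
      using gen_laguerre_hankel_X_Y[of "m + 1 + n" "m + 1" "n - 1" \<mu> "\<mu> + 1"]
      by (simp add: n f_def)
    moreover have "gen_laguerre m (n + 1) (\<mu> - 1) = hankel f 1 (Suc (Suc (Suc k)))"
      using gen_laguerre_hankel_1[of "m + 1 + n" m "n + 1" \<mu> "\<mu> - 1"] by (simp add: n f_def)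
    ultimately show "hirota (gen_laguerre (m + 1) n \<mu>) (gen_laguerre m n \<mu>)
        = gen_laguerre (m + 1) (n - 1) (\<mu> + 1) * gen_laguerre m (n + 1) (\<mu> - 1)"
      using hankel_jacobi_two_linear[OF XY linear_monom, of f "Suc k", folded hirota_def]
      by (simp only: hirota_sign) (simp add: mult_ac)
  }
  {
    assume "1 \<le> m \<and> 2 \<le> n"
    then have "m = Suc (m - 1)" "n = Suc (Suc (n - 2))" by auto
    then obtain m' k where mn: "m = Suc m'" "n = Suc (Suc k)" by blast
    \<comment> \<open>With s = X and t = X - 1, both products on the left carry the sign (-1)^(2k+3)
      = -1, which puts them in the order of \<open>hankel_discrete\<close>.\<close>
    define f where "f = laguerre (m + n) \<mu>"
    have "gen_laguerre m n \<mu> = (-1) ^ Suc (Suc k) * hankel f ?Y (Suc (Suc k))"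
      using gen_laguerre_hankel_Y[of "m + n" m n \<mu> \<mu>] by (simp add: mn f_def)
    moreover have "gen_laguerre m (n - 1) \<mu> = (-1) ^ Suc k * hankel f ?X (Suc k)"
      using gen_laguerre_hankel_X[of "m + n" m "n - 1" \<mu> \<mu>] by (simp add: mn f_def)
    moreover have "gen_laguerre (m - 1) n \<mu> = (-1) ^ Suc (Suc k) * hankel f ?X (Suc (Suc k))"
      using gen_laguerre_hankel_X[of "m + n" "m - 1" n \<mu> \<mu>] by (simp add: mn f_def)
    moreover have "gen_laguerre (m + 1) (n - 1) \<mu> = (-1) ^ Suc k * hankel f ?Y (Suc k)"
      using gen_laguerre_hankel_Y[of "m + n" "m + 1" "n - 1" \<mu> \<mu>] by (simp add: mn f_def)
    moreover have "gen_laguerre m n (\<mu> - 1) = hankel f 1 (Suc (Suc k))"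
      using gen_laguerre_hankel_1[of "m + n" m n \<mu> "\<mu> - 1"] by (simp add: mn f_def)
    moreover have "gen_laguerre m (n - 1) (\<mu> + 1) = hankel f (?X * ?Y) (Suc k)"
      using gen_laguerre_hankel_X_Y[of "m + n" m "n - 1" \<mu> "\<mu> + 1"] by (simp add: mn f_def)
    ultimately show "gen_laguerre m n \<mu> * gen_laguerre m (n - 1) \<mu>
          - gen_laguerre (m - 1) n \<mu> * gen_laguerre (m + 1) (n - 1) \<mu>
        = gen_laguerre m n (\<mu> - 1) * gen_laguerre m (n - 1) (\<mu> + 1)"
      using hankel_discrete[OF XY linear_monom, of f k] by (simp add: algebra_simps)
  }
qed

end
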